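(* Let $m\ge 1$ and let $G=(U\cup V,E)$ be a bipartite graph with $m$ edges. Then $h(G)\le m\log m$. Equality holds if and only if $G$, after deleting its isolated vertices, is a complete bipartite graph.
   Context: For $x\ge 0$ let $f(x)=x\log x$ (natural logarithm), with $f(0)=0$. For a graph $G$ with degree sequence $(d_v)_{v\in V(G)}$, $h(G)=\sum_{v} f(d_v)$. (The first-degree based entropy of $G$ is $I(G)=\log(2m)-\frac{1}{2m}h(G)$, so maximizing $h$ is minimizing the entropy.) *)

theory Defs
  imports "HOL-Analysis.Analysis" "Graph_Theory.Kuratowski"
begin

text \<open>
  A finite simple undirected graph is represented by the locale \<^locale>\<open>graph\<close>: a finite symmetric
  digraph without loops and multi-arcs. Each undirected edge \<open>{u, v}\<close> thus corresponds to two
  arcs, with ends \<open>(u, v)\<close> and \<open>(v, u)\<close>, so it must not be counted by \<^term>\<open>card (arcs G)\<close>.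
\<close>

definition edges :: "('a, 'b) pre_digraph \<Rightarrow> 'a set set" where
  "edges G = {{u, v} |u v. (u, v) \<in> arcs_ends G}"

definition vertex_degree :: "('a, 'b) pre_digraph \<Rightarrow> 'a \<Rightarrow> nat" where
  "vertex_degree G v = card {e \<in> edges G. v \<in> e}"

definition bipartite_with :: "('a, 'b) pre_digraph \<Rightarrow> 'a set \<Rightarrow> 'a set \<Rightarrow> bool" where
  "bipartite_with G U V \<longleftrightarrow>
     graph G \<and> verts G = U \<union> V \<and> U \<inter> V = {} \<and> arcs_ends G \<subseteq> U \<times> V \<union> V \<times> U"

definition xlogx :: "real \<Rightarrow> real" where
  "xlogx x = (if x = 0 then 0 else x * ln x)"

definition h_sum :: "('a, 'b) pre_digraph \<Rightarrow> real" where
  "h_sum G = (\<Sum>v\<in>verts G. xlogx (real (vertex_degree G v)))"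

definition delete_isolated :: "('a, 'b) pre_digraph \<Rightarrow> ('a, 'b) pre_digraph" where
  "delete_isolated G = G \<restriction> {v \<in> verts G. vertex_degree G v \<noteq> 0}"

text \<open>
  Both parts are required to be nonempty; otherwise every edgeless graph would qualify.
\<close>

definition complete_bipartite :: "('a, 'b) pre_digraph \<Rightarrow> bool" where
  "complete_bipartite G \<longleftrightarrow> (\<exists>a\<ge>1. \<exists>b\<ge>1. complete_bipartite_digraph a b G)"

end

theory Submission
  imports Defs
begin

text \<open>
  Let \<open>R\<close> be the set of edges oriented from \<open>U\<close> to \<open>V\<close>. Then \<open>h G\<close> is the sum of
  \<open>ln (d u * d v)\<close> over \<open>(u, v) \<in> R\<close>. With \<open>x u v = d u * d v / m\<close>, the numbers \<open>x u v\<close> sum to \<open>m\<close>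
  over all pairs of non-isolated vertices, so
  \<open>m ln m - h G = (\<Sum>R. x - 1 - ln x) + (\<Sum>complement of R. x)\<close>.
  Both sums are nonnegative, and the second vanishes only if every pair is an edge.
\<close>

section \<open>Degrees of a finite relation\<close>

text \<open>Grouping pairs by first component repeats \<open>f u\<close> once per neighbour of
  \<open>u\<close>. This trades degree-weighted vertex sums for edge sums; \<open>f = 1\<close>
  gives double counting.\<close>

lemma sum_fst_relation:
  fixes f :: "'a \<Rightarrow> real"
  assumes "finite R"
  shows "(\<Sum>(u, v)\<in>R. f u) = (\<Sum>u\<in>Domain R. real (card (R `` {u})) * f u)"
proof -
  have "R = Sigma (Domain R) (\<lambda>u. R `` {u})" by auto
  moreover have "(\<Sum>(u, v)\<in>Sigma (Domain R) (\<lambda>u. R `` {u}). f u)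
      = (\<Sum>u\<in>Domain R. \<Sum>v\<in>R `` {u}. f u)"
    using assms by (intro sum.Sigma[symmetric]) (auto simp: finite_Domain)
  ultimately show ?thesis by simp
qed

lemma sum_snd_relation:
  fixes f :: "'b \<Rightarrow> real"
  assumes "finite R"
  shows "(\<Sum>(u, v)\<in>R. f v) = (\<Sum>v\<in>Range R. real (card (R\<inverse> `` {v})) * f v)"
proof -
  have "(\<Sum>(u, v)\<in>R. f v) = (\<Sum>(v, u)\<in>R\<inverse>. f v)"
    by (rule sum.reindex_bij_witness[of _ prod.swap prod.swap]) auto
  also have "\<dots> = (\<Sum>v\<in>Domain (R\<inverse>). real (card (R\<inverse> `` {v})) * f v)"
    using assms by (intro sum_fst_relation) simp
  finally show ?thesis by simp
qed

text \<open>Summing over \<open>Domain R\<close> and \<open>Range R\<close> only keeps every degree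
  positive, so all logarithm laws apply.\<close>

lemma relation_degree_entropy:
  fixes R :: "('a \<times> 'b) set"
  assumes fin: "finite R" and ne: "R \<noteq> {}"
  defines "a \<equiv> \<lambda>u. real (card (R `` {u}))" and "b \<equiv> \<lambda>v. real (card (R\<inverse> `` {v}))"
    and "M \<equiv> real (card R)"
  defines "S \<equiv> (\<Sum>u\<in>Domain R. a u * ln (a u)) + (\<Sum>v\<in>Range R. b v * ln (b v))"
  shows "S \<le> M * ln M" and "S = M * ln M \<longleftrightarrow> Domain R \<times> Range R = R"
proof -
  let ?P = "Domain R \<times> Range R"
  \<comment> \<open>\<open>x p / M\<close> is the product of the two marginals of the uniform
    distribution on \<open>R\<close>. The gap \<open>M * ln M - S\<close> is thus \<open>M\<close>
    times a mutual information.\<close>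
  define x where "x = (\<lambda>(u, v). a u * b v / M)"
  have M: "M > 0" using fin ne by (simp add: M_def card_gt_0_iff)
  have finP: "finite ?P" using fin by (simp add: finite_Domain finite_Range)
  have sub: "R \<subseteq> ?P" by auto
  have a_pos: "a u > 0" if "u \<in> Domain R" for u
    using that fin by (auto simp: a_def card_gt_0_iff)
  have b_pos: "b v > 0" if "v \<in> Range R" for v
    using that fin by (auto simp: b_def card_gt_0_iff)
  have x_pos: "x p > 0" if "p \<in> ?P" for p
  proof -
    obtain u v where p: "p = (u, v)" "u \<in> Domain R" "v \<in> Range R" using \<open>p \<in> ?P\<close> by (rule SigmaE)
    then show ?thesis using a_pos[OF p(2)] b_pos[OF p(3)] M by (simp add: x_def)
  qed
  have S: "S = (\<Sum>(u, v)\<in>R. ln (a u * b v))"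
  proof -
    have "S = (\<Sum>(u, v)\<in>R. ln (a u)) + (\<Sum>(u, v)\<in>R. ln (b v))"
      unfolding S_def a_def b_def by (simp only: sum_fst_relation[OF fin] sum_snd_relation[OF fin])
    also have "\<dots> = (\<Sum>(u, v)\<in>R. ln (a u) + ln (b v))"
      by (simp add: sum.distrib split_def)
    also have "\<dots> = (\<Sum>(u, v)\<in>R. ln (a u * b v))"
    proof (rule sum.cong[OF refl], clarify)
      fix u v assume "(u, v) \<in> R"
      then have "a u > 0" "b v > 0" by (auto intro: a_pos b_pos)
      then show "ln (a u) + ln (b v) = ln (a u * b v)" by (simp add: ln_mult)
    qed
    finally show ?thesis .
  qed
  have sum_x: "(\<Sum>p\<in>?P. x p) = M"
  proof -
    \<comment> \<open>Double counting: the degrees on either side sum to the number of pairs, so the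
      factorised sum of \<open>x\<close> is \<open>M * M / M\<close>.\<close>
    have "sum a (Domain R) = M" "sum b (Range R) = M"
      using sum_fst_relation[OF fin, of "\<lambda>_. 1"] sum_snd_relation[OF fin, of "\<lambda>_. 1"]
      by (simp_all add: a_def b_def M_def)
    moreover have "(\<Sum>p\<in>?P. x p) = sum a (Domain R) * sum b (Range R) / M"
      by (simp add: x_def sum_product sum.cartesian_product sum_divide_distrib split_def)
    ultimately show ?thesis using M by simp
  qed
  have "S - M * ln M = (\<Sum>p\<in>R. ln (x p))"
  proof -
    have "(\<Sum>p\<in>R. ln (x p)) = (\<Sum>(u, v)\<in>R. ln (a u * b v) - ln M)"
    proof (rule sum.cong[OF refl], clarify)
      fix u v assume "(u, v) \<in> R"
      then have "a u > 0" "b v > 0" by (auto intro: a_pos b_pos)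
      then show "ln (x (u, v)) = ln (a u * b v) - ln M" using M by (simp add: x_def ln_div)
    qed
    also have "\<dots> = S - M * ln M"
      by (simp add: S sum_subtractf split_def M_def)
    finally show ?thesis by simp
  qed
  \<comment> \<open>\<open>M\<close> is both the total of \<open>x\<close> on \<open>?P\<close> and
    the sum of 1 over \<open>R\<close>; inserting their zero difference completes each
    \<open>- ln (x p)\<close> to \<open>x p - 1 - ln (x p)\<close>.\<close>
  moreover have "M = sum x (?P - R) + sum x R"
    using sum_x sum.subset_diff[OF sub finP, of x] by simp
  ultimately have gap:
    "M * ln M - S = (\<Sum>p\<in>R. x p - 1 - ln (x p)) + (\<Sum>p\<in>?P - R. x p)"
    by (simp add: sum_subtractf M_def)
  have nonneg: "(\<Sum>p\<in>R. x p - 1 - ln (x p)) \<ge> 0"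
    using x_pos sub by (intro sum_nonneg) (simp add: ln_le_minus_one subset_eq)
  have nonneg': "(\<Sum>p\<in>?P - R. x p) \<ge> 0"
    using x_pos by (intro sum_nonneg) (auto intro: less_imp_le)
  show "S \<le> M * ln M" using gap nonneg nonneg' by linarith
  show "S = M * ln M \<longleftrightarrow> ?P = R"
  proof
    assume "S = M * ln M"
    then have "(\<Sum>p\<in>?P - R. x p) = 0" using gap nonneg nonneg' by linarith
    then have "?P - R = {}"
      using x_pos finP by (metis Diff_iff finite_Diff sum_pos less_irrefl)
    then show "?P = R" using sub by blast
  next
    assume P: "?P = R"
    \<comment> \<open>In a full product each degree is the size of the opposite side, so
      \<open>x\<close> is constantly 1.\<close>
    have "a u * b v = M" if "(u, v) \<in> R" for u v
    proof -
      have "R `` {u} = Range R" "R\<inverse> `` {v} = Domain R" using P that by blast+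
      moreover have "card R = card (Domain R) * card (Range R)"
        using card_cartesian_product[of "Domain R" "Range R"] P by simp
      ultimately show ?thesis by (simp add: a_def b_def M_def)
    qed
    then have "S = (\<Sum>(u, v)\<in>R. ln M)" unfolding S by (intro sum.cong) auto
    then show "S = M * ln M" by (simp add: M_def split_def)
  qed
qed

section \<open>Bipartite graphs as relations\<close>

locale bipartition =
  fixes G :: "('a, 'b) pre_digraph" and U V :: "'a set"
  assumes bip: "bipartite_with G U V"
begin

sublocale graph G using bip by (simp add: bipartite_with_def)

definition R :: "('a \<times> 'a) set" where "R = arcs_ends G \<inter> U \<times> V"

lemma verts_eq: "verts G = U \<union> V" and disjoint: "U \<inter> V = {}"
  using bip by (auto simp: bipartite_with_def)

lemma arcs_ends_eq: "arcs_ends G = R \<union> R\<inverse>"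
proof -
  have "arcs_ends G \<subseteq> U \<times> V \<union> V \<times> U" using bip by (simp add: bipartite_with_def)
  then show ?thesis unfolding R_def using arcs_ends_symmetric[OF sym_arcs] by blast
qed

lemma R_subset: "R \<subseteq> U \<times> V"
  by (auto simp: R_def)

lemma finite_R: "finite R"
  by (simp add: R_def arcs_ends_def)

lemma edges_eq: "edges G = (\<lambda>(u, v). {u, v}) ` R"
  by (auto simp: edges_def arcs_ends_eq insert_commute)

text \<open>Disjointness of \<open>U\<close> and \<open>V\<close> rules out the swapped reading of a
  doubleton, so each edge has a single orientation in \<open>R\<close>.\<close>

lemma inj_on_R: "inj_on (\<lambda>(u, v). {u, v}) R"
proof (rule inj_onI, clarify)
  fix u v u' v' assume "(u, v) \<in> R" "(u', v') \<in> R" "{u, v} = {u', v'}"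
  then show "u = u' \<and> v = v'"
    using R_subset disjoint unfolding doubleton_eq_iff by blast
qed

lemma card_edges: "card (edges G) = card R"
  by (simp add: edges_eq card_image inj_on_R)

lemma vertex_degree_left:
  assumes "u \<in> U" shows "vertex_degree G u = card (R `` {u})"
proof -
  have "{e \<in> edges G. u \<in> e} = (\<lambda>v. {u, v}) ` (R `` {u})"
    using assms R_subset disjoint by (auto simp: edges_eq)
  moreover have "inj_on (\<lambda>v. {u, v}) (R `` {u})"
    by (auto simp: inj_on_def doubleton_eq_iff)
  ultimately show ?thesis by (simp add: vertex_degree_def card_image)
qed

lemma vertex_degree_right:
  assumes "v \<in> V" shows "vertex_degree G v = card (R\<inverse> `` {v})"
proof -
  have "{e \<in> edges G. v \<in> e} = (\<lambda>u. {u, v}) ` (R\<inverse> `` {v})"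
    using assms R_subset disjoint by (auto simp: edges_eq)
  moreover have "inj_on (\<lambda>u. {u, v}) (R\<inverse> `` {v})"
    by (auto simp: inj_on_def doubleton_eq_iff)
  ultimately show ?thesis by (simp add: vertex_degree_def card_image)
qed

lemma h_sum_eq:
  "h_sum G = (\<Sum>u\<in>Domain R. real (card (R `` {u})) * ln (real (card (R `` {u}))))
    + (\<Sum>v\<in>Range R. real (card (R\<inverse> `` {v})) * ln (real (card (R\<inverse> `` {v}))))"
proof -
  have fin: "finite U" "finite V" using finite_verts verts_eq by auto
  \<comment> \<open>At \<open>t = 0\<close> the factor \<open>t\<close> makes the product 0, in
    agreement with the convention.\<close>
  have xlogx: "xlogx t = t * ln t" for t by (simp add: xlogx_def)
  have empty: "R `` {u} = {}" if "u \<notin> Domain R" for u using that by blast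
  have empty': "R\<inverse> `` {v} = {}" if "v \<notin> Range R" for v using that by blast
  have "h_sum G = (\<Sum>u\<in>U. xlogx (vertex_degree G u)) + (\<Sum>v\<in>V. xlogx (vertex_degree G v))"
    unfolding h_sum_def verts_eq by (rule sum.union_disjoint[OF fin disjoint])
  also have "(\<Sum>u\<in>U. xlogx (vertex_degree G u))
      = (\<Sum>u\<in>U. real (card (R `` {u})) * ln (real (card (R `` {u}))))"
    by (simp add: xlogx vertex_degree_left)
  \<comment> \<open>Isolated vertices contribute 0 and drop out.\<close>
  also have "\<dots> = (\<Sum>u\<in>Domain R. real (card (R `` {u})) * ln (real (card (R `` {u}))))"
    using R_subset fin by (intro sum.mono_neutral_right) (auto simp: empty)
  also have "(\<Sum>v\<in>V. xlogx (vertex_degree G v))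
      = (\<Sum>v\<in>V. real (card (R\<inverse> `` {v})) * ln (real (card (R\<inverse> `` {v}))))"
    by (simp add: xlogx vertex_degree_right)
  also have "\<dots> = (\<Sum>v\<in>Range R. real (card (R\<inverse> `` {v})) * ln (real (card (R\<inverse> `` {v}))))"
    using R_subset fin by (intro sum.mono_neutral_right) (auto simp: empty')
  finally show ?thesis .
qed

section \<open>Isolated vertices and completeness\<close>

lemma non_isolated_eq: "{v \<in> verts G. vertex_degree G v \<noteq> 0} = Domain R \<union> Range R"
proof -
  \<comment> \<open>Finiteness matters: \<open>card\<close> of an infinite image would also be
    0.\<close>
  have "vertex_degree G u \<noteq> 0 \<longleftrightarrow> u \<in> Domain R" if "u \<in> U" for u
    using that finite_R by (auto simp: vertex_degree_left)
  moreover have "vertex_degree G v \<noteq> 0 \<longleftrightarrow> v \<in> Range R" if "v \<in> V" for v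
    using that finite_R by (auto simp: vertex_degree_right)
  ultimately show ?thesis using R_subset unfolding verts_eq by blast
qed

lemma verts_delete_isolated: "verts (delete_isolated G) = Domain R \<union> Range R"
  unfolding delete_isolated_def non_isolated_eq by simp

text \<open>Both ends of an arc are non-isolated, so the induced subgraph loses none.\<close>

lemma arcs_delete_isolated: "arcs (delete_isolated G) = arcs G"
proof -
  have "tail G e \<in> Domain R \<union> Range R \<and> head G e \<in> Domain R \<union> Range R" if "e \<in> arcs G" for e
  proof -
    have "(tail G e, head G e) \<in> R \<union> R\<inverse>"
      using that by (auto simp: arcs_ends_conv simp flip: arcs_ends_eq)
    then show ?thesis by auto
  qed
  then show ?thesis unfolding delete_isolated_def non_isolated_eq by auto
qed

lemma arcs_ends_delete_isolated: "arcs_ends (delete_isolated G) = R \<union> R\<inverse>"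
proof -
  have "arcs_ends (delete_isolated G) = arcs_ends G"
    unfolding arcs_ends_conv arcs_delete_isolated by (simp add: delete_isolated_def)
  then show ?thesis by (simp add: arcs_ends_eq)
qed

lemma graph_delete_isolated: "graph (delete_isolated G)"
proof -
  have "induced_subgraph (delete_isolated G) G"
    unfolding delete_isolated_def by (rule induced_induce) auto
  then show ?thesis
    using digraphI_induced induced_graph_imp_symmetric[OF sym_arcs] digraph.graphI by blast
qed

text \<open>The parts \<open>A\<close>, \<open>B\<close> witnessing completeness need not come as
  \<open>Domain R\<close>, \<open>Range R\<close>. Instead of matching them up, the forward
  direction shows that any \<open>u\<close> in \<open>Domain R\<close> and \<open>v\<close> in
  \<open>Range R\<close> lie in opposite parts.\<close>

lemma complete_bipartite_delete_isolated_iff: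
  assumes "R \<noteq> {}"
  shows "complete_bipartite (delete_isolated G) \<longleftrightarrow> Domain R \<times> Range R = R"
proof
  assume "complete_bipartite (delete_isolated G)"
  then obtain A B where ne: "A \<noteq> {}" "B \<noteq> {}" and AB: "Domain R \<union> Range R = A \<union> B"
    and ends: "R \<union> R\<inverse> = A \<times> B \<union> B \<times> A"
    unfolding complete_bipartite_def complete_bipartite_digraph_def
      verts_delete_isolated arcs_ends_delete_isolated
    by (metis card.empty not_one_le_zero)
  have "(u, v) \<in> R" if "u \<in> Domain R" "v \<in> Range R" for u v
  proof -
    have uv: "u \<in> U" "v \<in> V" "u \<notin> V" "v \<notin> U"
      using that R_subset disjoint by auto
    \<comment> \<open>A common neighbour of \<open>u\<close> and \<open>v\<close> would lie in both \<open>U\<close> and \<open>V\<close>.\<close>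
    have no_common: False if "(u, w) \<in> R \<union> R\<inverse>" "(v, w) \<in> R \<union> R\<inverse>" for w
      using that uv R_subset disjoint by blast
    have "(u, v) \<in> A \<times> B \<union> B \<times> A"
    proof (rule ccontr)
      assume "(u, v) \<notin> A \<times> B \<union> B \<times> A"
      then have "u \<in> A \<and> v \<in> A \<or> u \<in> B \<and> v \<in> B" using that AB by blast
      \<comment> \<open>Vertices in the same part have every vertex of the other, nonempty part as a
        common neighbour.\<close>
      then obtain w where "(u, w) \<in> A \<times> B \<union> B \<times> A" "(v, w) \<in> A \<times> B \<union> B \<times> A"
        using ne by blast
      then show False using no_common ends by blast
    qed
    then have "(u, v) \<in> R \<union> R\<inverse>" using ends by blast
    \<comment> \<open>The reverse orientation fails because \<open>u\<close> is not in
      \<open>V\<close>.\<close>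
    then show ?thesis using uv R_subset by blast
  qed
  then show "Domain R \<times> Range R = R" by auto
next
  assume eq: "Domain R \<times> Range R = R"
  \<comment> \<open>One edge already puts a vertex on each side.\<close>
  have "card (Domain R) \<ge> 1" "card (Range R) \<ge> 1"
    using assms finite_R by (auto simp: Suc_le_eq card_gt_0_iff finite_Domain finite_Range)
  moreover have "Domain R \<inter> Range R = {}" using R_subset disjoint by auto
  moreover have "R \<union> R\<inverse> = Domain R \<times> Range R \<union> Range R \<times> Domain R" using eq by blast
  ultimately show "complete_bipartite (delete_isolated G)"
    unfolding complete_bipartite_def complete_bipartite_digraph_def
      verts_delete_isolated arcs_ends_delete_isolated
    using graph_delete_isolated by blast
qed

end

theorem theorem1:
  fixes G :: "('a, 'b) pre_digraph" and U V :: "'a set" and m :: nat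
  assumes "m \<ge> 1"
    and "bipartite_with G U V"
    and "card (edges G) = m"
  shows "h_sum G \<le> real m * ln (real m) \<and>
         (h_sum G = real m * ln (real m) \<longleftrightarrow> complete_bipartite (delete_isolated G))"
proof -
  interpret bipartition G U V using assms(2) by unfold_locales
  have "card R = m" using assms(3) by (simp add: card_edges)
  moreover from this have "R \<noteq> {}" using assms(1) by auto
  ultimately show ?thesis
    using relation_degree_entropy[OF finite_R] complete_bipartite_delete_isolated_iff
    by (simp add: h_sum_eq)
qed

end
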